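(* Let $n\ge 3$, $z\in\mathbb{R}$, let $z_h\in\mathbb{R}$ ($h>0$) satisfy $z_h-z=\mathcal O(h)$ as $h\to0^+$, let $a_0<a_1<\dots<a_n$ be fixed real numbers, and consider the stencil $x_{i,h}=z_h+a_ih$, $0\le i\le n$. Then, as $h\to 0^+$: (1) If there exists $h_0>0$ such that $x_{0,h}<z<x_{n,h}$ for all $0<h<h_0$, and $f$ has a jump discontinuity at $z$ (in the sense given in the context), then $\Delta_n\bigl(f(x_{0,h}),\dots,f(x_{n,h})\bigr)=\bar{\mathcal O}(1)$. (2) If $f$ is of class $C^{n+1}$ in a neighbourhood of $z$ with $f^{(l)}(z)=0$ for $1\le l\le n-1$ and $f^{(n)}(z)\ne 0$, then $\Delta_n\bigl(f(x_{0,h}),\dots,f(x_{n,h})\bigr)=\mathcal O(h^{2n+1})$.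
   Context: Definition of $\Delta_n$: for fixed $a_0<\dots<a_n$ and values $g_0,\dots,g_n\in\mathbb{R}$, let $P$ be the unique real polynomial of degree at most $n$ with $P(a_i)=g_i$, $0\le i\le n$, and write its $(n-2)$-th derivative as $P^{(n-2)}(w)=Aw^2+Bw+C$. Then $\Delta_n(g_0,\dots,g_n):=B^2-4AC$. (For $g_i=f(x_{i,h})$, $P(w)=p_h(z_h+wh)$ where $p_h$ is the polynomial of degree at most $n$ interpolating $f$ at the $x_{i,h}$.) Jump discontinuity at $z$: $f$ is continuous in a punctured neighbourhood of $z$, the one-sided limits $f(z^-)$ and $f(z^+)$ exist and are finite, $f(z^-)\ne f(z^+)$, and $f(z)\in\{f(z^-),f(z^+)\}$. $g(h)=\bar{\mathcal O}(1)$ means $\limsup_{h\to0^+}|g(h)|<\infty$ and $\liminf_{h\to0^+}|g(h)|>0$. *)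

theory Defs
  imports
    "HOL-Analysis.Analysis"
    "HOL-Computational_Algebra.Polynomial"
    "HOL-Library.Landau_Symbols"
begin

definition interp_poly :: "nat \<Rightarrow> (nat \<Rightarrow> real) \<Rightarrow> (nat \<Rightarrow> real) \<Rightarrow> real poly" where
  "interp_poly n a g = (THE P. degree P \<le> n \<and> (\<forall>i\<le>n. poly P (a i) = g i))"

lemma ex1_interp_poly:
  fixes a g :: "nat \<Rightarrow> real"
  assumes "inj_on a {..n}"
  shows "\<exists>!P. degree P \<le> n \<and> (\<forall>i\<le>n. poly P (a i) = g i)"
proof (rule ex_ex1I)
  show "\<exists>P. degree P \<le> n \<and> (\<forall>i\<le>n. poly P (a i) = g i)"
    using assms
  proof (induction n)
    case 0
    show ?case by (rule exI[of _ "[:g 0:]"]) simp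
  next
    case (Suc n)
    have "inj_on a {..n}"
      using Suc.prems by (rule inj_on_subset) auto
    then obtain P where P: "degree P \<le> n" "\<forall>i\<le>n. poly P (a i) = g i"
      using Suc.IH by blast
    define Q where "Q = (\<Prod>i\<le>n. [:- a i, 1:])"
    have Q: "poly Q x = (\<Prod>i\<le>n. x - a i)" for x
      by (simp add: Q_def poly_prod)
    have deg: "degree Q = Suc n"
      by (simp add: Q_def degree_prod_eq_sum_degree)
    have Q0: "poly Q (a i) = 0" if "i \<le> n" for i
      using that by (auto simp: Q)
    have Q1: "poly Q (a (Suc n)) \<noteq> 0"
      using inj_onD[OF Suc.prems, of "Suc n"] by (fastforce simp: Q)
    define R where "R = P + smult ((g (Suc n) - poly P (a (Suc n))) / poly Q (a (Suc n))) Q"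
    have "degree R \<le> Suc n"
      unfolding R_def using P(1) deg
      by (intro degree_add_le) (auto intro: order_trans[OF degree_smult_le])
    moreover have "\<forall>i\<le>Suc n. poly R (a i) = g i"
      using P(2) Q0 Q1 by (auto simp: R_def le_Suc_eq)
    ultimately show ?case by blast
  qed
next
  fix P Q
  assume P: "degree P \<le> n \<and> (\<forall>i\<le>n. poly P (a i) = g i)"
    and Q: "degree Q \<le> n \<and> (\<forall>i\<le>n. poly Q (a i) = g i)"
  have "card (a ` {..n}) = Suc n"
    using assms by (simp add: card_image)
  then show "P = Q"
    using P Q by (intro poly_eqI_degree[of "a ` {..n}"]) auto
qed

text \<open>Only used for \<open>n \<ge> 2\<close>; the derivative \<open>Q\<close> then has degree at most 2,
  so its coefficients of index 2, 1, 0 are \<open>A\<close>, \<open>B\<close>, \<open>C\<close>.\<close>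

definition Delta :: "nat \<Rightarrow> (nat \<Rightarrow> real) \<Rightarrow> (nat \<Rightarrow> real) \<Rightarrow> real" where
  "Delta n a g =
     (let Q = (pderiv ^^ (n - 2)) (interp_poly n a g);
          A = poly.coeff Q 2; B = poly.coeff Q 1; C = poly.coeff Q 0
      in B\<^sup>2 - 4 * A * C)"

definition jump_discontinuity :: "(real \<Rightarrow> real) \<Rightarrow> real \<Rightarrow> bool" where
  "jump_discontinuity f z \<longleftrightarrow>
     (\<exists>\<epsilon>>0. continuous_on (ball z \<epsilon> - {z}) f) \<and>
     (\<exists>L R. (f \<longlongrightarrow> L) (at_left z) \<and> (f \<longlongrightarrow> R) (at_right z) \<and> L \<noteq> R \<and> f z \<in> {L, R})"

definition bar_O_1 :: "(real \<Rightarrow> real) \<Rightarrow> bool" where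
  "bar_O_1 g \<longleftrightarrow>
     Limsup (at_right 0) (\<lambda>h. ereal \<bar>g h\<bar>) < \<infinity> \<and>
     Liminf (at_right 0) (\<lambda>h. ereal \<bar>g h\<bar>) > 0"

text \<open>Meant for open \<open>U\<close>: the derivatives are two-sided.\<close>

definition C_class_on :: "nat \<Rightarrow> (real \<Rightarrow> real) \<Rightarrow> real set \<Rightarrow> bool" where
  "C_class_on k f U \<longleftrightarrow>
     (\<forall>l<k. \<forall>x\<in>U. ((deriv ^^ l) f) field_differentiable (at x)) \<and>
     continuous_on U ((deriv ^^ k) f)"

end

theory Submission
  imports Defs
begin

text \<open>\<open>Delta\<close> is a quadratic form in the data. At a jump the data are asymptotically a step
  vector \<open>(L, \<dots>, L, R, \<dots>, R)\<close>. For such a vector Rolle's theorem, applied on every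
  interval except the one carrying the step, gives \<open>n - 1\<close> real roots of \<open>P'\<close>, hence all of them
  are real and simple, and so are the two roots of \<open>P\<^sup>(\<^sup>n\<^sup>-\<^sup>2\<^sup>)\<close>:
  the discriminant is positive. Only finitely many step vectors occur, which gives uniform bounds.
  In the smooth case the data are \<open>f z + c (x\<^sub>i - z)\<^sup>n\<close> up to \<open>O(h\<^sup>n\<^sup>+\<^sup>1)\<close>;
  the leading part is interpolated exactly and its \<open>(n - 2)\<close>-nd derivative is a multiple of a square,
  so it has discriminant 0, while the cross terms are \<open>O(h\<^sup>n) O(h\<^sup>n\<^sup>+\<^sup>1)\<close>.\<close>

section \<open>Roots of derivatives\<close>

text \<open>Rolle on each interval \<open>(a i, a (Suc i))\<close> with \<open>i \<in> I\<close>.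
  These intervals are disjoint, so the chosen roots increase with \<open>i\<close> and are distinct.
  The index set \<open>I\<close> is arbitrary so that an interval carrying a jump of the values can
  be left out.\<close>

lemma card_le_card_pderiv_roots:
  fixes P :: "real poly"
  assumes mono: "strict_mono_on {..n} a" and I: "I \<subseteq> {..<n}"
    and eq: "\<And>i. i \<in> I \<Longrightarrow> poly P (a i) = poly P (a (Suc i))"
    and nz: "pderiv P \<noteq> 0"
  shows "card I \<le> card {x. poly (pderiv P) x = 0}"
proof -
  have "\<exists>x. a i < x \<and> x < a (Suc i) \<and> poly (pderiv P) x = 0" if "i \<in> I" for i
  proof -
    have less: "a i < a (Suc i)"
      using mono I that by (intro strict_mono_onD[OF mono]) auto
    show ?thesis
      using poly_MVT[OF less, of P] eq[OF that] less by auto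
  qed
  then obtain r where r: "\<And>i. i \<in> I \<Longrightarrow> a i < r i \<and> r i < a (Suc i) \<and> poly (pderiv P) (r i) = 0"
    by metis
  have less: "r i < r j" if "i \<in> I" "j \<in> I" "i < j" for i j
  proof -
    have "a (Suc i) \<le> a j"
      using that I by (intro strict_mono_on_leD[OF mono]) auto
    then show ?thesis
      using r[OF that(1)] r[OF that(2)] by linarith
  qed
  have "inj_on r I"
    by (rule linorder_inj_onI) (use less in \<open>force+\<close>)
  then show ?thesis
    using r nz by (intro card_inj_on_le[of r]) (auto intro: poly_roots_finite)
qed

lemma card_roots_le_Suc_card_pderiv_roots:
  fixes P :: "real poly"
  assumes nz: "pderiv P \<noteq> 0"
  shows "card {x. poly P x = 0} \<le> Suc (card {x. poly (pderiv P) x = 0})"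
proof (cases "card {x. poly P x = 0}")
  case (Suc k)
  define S where "S = {x. poly P x = 0}"
  define xs where "xs = sorted_list_of_set S"
  \<comment> \<open>\<open>card\<close> is 0 on infinite sets, so a successor as cardinality entails
    finiteness.\<close>
  have "finite S"
    using Suc by (metis S_def card.infinite nat.distinct(1))
  then have xs: "sorted_wrt (<) xs" "set xs = S" "length xs = Suc k"
    using Suc by (auto simp: xs_def S_def)
  have "strict_mono_on {..k} (\<lambda>i. xs ! i)"
    using xs by (intro strict_mono_onI sorted_wrt_nth_less[where P = "(<)"]) auto
  moreover have "poly P (xs ! i) = 0" if "i < Suc k" for i
    using nth_mem[of i xs] that xs by (auto simp: S_def)
  ultimately have "card {..<k} \<le> card {x. poly (pderiv P) x = 0}"
    by (intro card_le_card_pderiv_roots[where a = "\<lambda>i. xs ! i", OF _ _ _ nz]) auto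
  then show ?thesis
    using Suc by simp
qed simp

lemma card_roots_le_card_higher_pderiv_roots:
  fixes P :: "real poly"
  assumes "(pderiv ^^ m) P \<noteq> 0"
  shows "card {x. poly P x = 0} \<le> m + card {x. poly ((pderiv ^^ m) P) x = 0}"
  using assms
proof (induction m)
  case (Suc m)
  then have "(pderiv ^^ m) P \<noteq> 0"
    by auto
  then show ?case
    using Suc card_roots_le_Suc_card_pderiv_roots[of "(pderiv ^^ m) P"] by simp
qed simp

text \<open>Two distinct roots \<open>u\<close>, \<open>v\<close> give Vieta's relations, which turn
  the discriminant into \<open>(A * (u - v))\<^sup>2\<close>.\<close>

lemma discriminant_pos:
  fixes Q :: "real poly"
  assumes deg: "degree Q = 2" and roots: "card {x. poly Q x = 0} \<ge> 2"
  shows "(poly.coeff Q 1)\<^sup>2 - 4 * poly.coeff Q 2 * poly.coeff Q 0 > 0"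
proof -
  obtain u v where uv: "poly Q u = 0" "poly Q v = 0" "u \<noteq> v"
    using roots by (auto simp: numeral_2_eq_2 card_le_Suc_iff)
  define A B C where "A = poly.coeff Q 2" and "B = poly.coeff Q 1" and "C = poly.coeff Q 0"
  have Q: "poly Q x = A * x\<^sup>2 + B * x + C" for x
    by (simp add: poly_altdef deg A_def B_def C_def numeral_2_eq_2 algebra_simps)
  have "A \<noteq> 0"
    using deg by (metis A_def degree_0 leading_coeff_0_iff zero_neq_numeral)
  \<comment> \<open>This is \<open>poly Q u - poly Q v\<close>, factored.\<close>
  have "(u - v) * (A * (u + v) + B) = 0"
    using uv by (simp add: Q algebra_simps power2_eq_square)
  then have B: "B = - A * (u + v)"
    using uv(3) by simp
  have C: "C = A * u * v"
    using uv(1) by (simp add: Q B algebra_simps power2_eq_square)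
  have "B\<^sup>2 - 4 * A * C = (A * (u - v))\<^sup>2"
    by (simp add: B C algebra_simps power2_eq_square)
  then show ?thesis
    using \<open>A \<noteq> 0\<close> uv(3) by (simp add: A_def B_def C_def)
qed

section \<open>Interpolation\<close>

lemma interp_poly_eqI:
  assumes "inj_on a {..n}" "degree P \<le> n" "\<And>i. i \<le> n \<Longrightarrow> poly P (a i) = g i"
  shows "interp_poly n a g = P"
  unfolding interp_poly_def
  by (rule the1_equality[OF ex1_interp_poly[OF assms(1)]]) (use assms in auto)

lemma
  assumes "inj_on a {..n}"
  shows degree_interp_poly: "degree (interp_poly n a g) \<le> n"
    and poly_interp_poly: "i \<le> n \<Longrightarrow> poly (interp_poly n a g) (a i) = g i"
  using theI'[OF ex1_interp_poly[OF assms, of g]] by (auto simp: interp_poly_def)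

lemma interp_poly_cong:
  assumes "\<And>i. i \<le> n \<Longrightarrow> g i = g' i"
  shows "interp_poly n a g = interp_poly n a g'"
  using assms by (auto simp: interp_poly_def intro!: arg_cong[where f = The])

lemma Delta_cong:
  assumes "\<And>i. i \<le> n \<Longrightarrow> g i = g' i"
  shows "Delta n a g = Delta n a g'"
  using interp_poly_cong[OF assms] by (simp add: Delta_def)

text \<open>For \<open>k\<close> = 2, 1, 0 these are the \<open>A\<close>, \<open>B\<close>,
  \<open>C\<close> inside \<open>Delta\<close>. Each is linear in the data \<open>g\<close>, so
  estimates are made here and then carried over to the quadratic form.\<close>

definition interp_coeff :: "nat \<Rightarrow> (nat \<Rightarrow> real) \<Rightarrow> nat \<Rightarrow> (nat \<Rightarrow> real) \<Rightarrow> real" where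
  "interp_coeff n a k g = poly.coeff ((pderiv ^^ (n - 2)) (interp_poly n a g)) k"

lemma Delta_eq_interp_coeff:
  "Delta n a g = (interp_coeff n a 1 g)\<^sup>2 - 4 * interp_coeff n a 2 g * interp_coeff n a 0 g"
  by (simp add: Delta_def interp_coeff_def Let_def)

lemma interp_coeff_add:
  assumes "inj_on a {..n}"
  shows "interp_coeff n a k (\<lambda>i. g i + g' i) = interp_coeff n a k g + interp_coeff n a k g'"
proof -
  have "interp_poly n a (\<lambda>i. g i + g' i) = interp_poly n a g + interp_poly n a g'"
    using assms
    by (intro interp_poly_eqI degree_add_le) (auto simp: degree_interp_poly poly_interp_poly)
  then show ?thesis
    by (simp add: interp_coeff_def higher_pderiv_add)
qed

text \<open>Expansion in the Lagrange basis: the data \<open>of_bool (i = j)\<close> are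
  interpolated by the \<open>i\<close>-th basis polynomial. The weights depend on the nodes
  \<open>a\<close> alone, so for data varying with \<open>h\<close> they are constants.\<close>

lemma interp_coeff_eq_sum:
  assumes "inj_on a {..n}"
  shows "interp_coeff n a k g = (\<Sum>i\<le>n. g i * interp_coeff n a k (\<lambda>j. of_bool (i = j)))"
proof -
  have "interp_poly n a g = (\<Sum>i\<le>n. smult (g i) (interp_poly n a (\<lambda>j. of_bool (i = j))))"
    using assms
    by (intro interp_poly_eqI degree_sum_le)
       (auto simp: poly_interp_poly poly_sum intro: order_trans[OF degree_smult_le] degree_interp_poly)
  then show ?thesis
    by (simp add: interp_coeff_def higher_pderiv_sum higher_pderiv_smult coeff_sum)
qed

lemma interp_coeff_bigo:
  assumes "inj_on a {..n}" "\<And>i. i \<le> n \<Longrightarrow> (\<lambda>h. e h i) \<in> O[F](q)"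
  shows "(\<lambda>h. interp_coeff n a k (e h)) \<in> O[F](q)"
  unfolding interp_coeff_eq_sum[OF assms(1), of k "e _"]
  using assms(2) by (intro big_sum_in_bigo) auto

text \<open>In the difference the terms quadratic in \<open>s\<close> cancel. Cross terms are of
  size \<open>p * q\<close>, and terms quadratic in \<open>e\<close> are absorbed because
  \<open>q\<close> is \<open>O(p)\<close>. The bound on \<open>s\<close> concerns its coefficients
  instead of its values: in the smooth case the values contain the constant \<open>f z\<close>,
  while the coefficients are \<open>O(h^n)\<close>.\<close>

lemma Delta_perturb_bigo:
  assumes inj: "inj_on a {..n}"
    and s: "\<And>k. (\<lambda>h. interp_coeff n a k (s h)) \<in> O[F](p)"
    and e: "\<And>i. i \<le> n \<Longrightarrow> (\<lambda>h. e h i) \<in> O[F](q)"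
    and qp: "q \<in> O[F](p)"
  shows "(\<lambda>h. Delta n a (\<lambda>i. s h i + e h i) - Delta n a (s h)) \<in> O[F](\<lambda>h. p h * q h)"
proof -
  define S where "S k h = interp_coeff n a k (s h)" for k h
  define E where "E k h = interp_coeff n a k (e h)" for k h
  have "E k \<in> O[F](q)" for k
    unfolding E_def using inj e by (rule interp_coeff_bigo)
  moreover have "E k \<in> O[F](p)" for k
    using calculation qp by (rule landau_o.big_trans)
  moreover have "S k \<in> O[F](p)" for k
    using s by (simp add: S_def [abs_def])
  ultimately have SE: "(\<lambda>h. S k h * E l h) \<in> O[F](\<lambda>h. p h * q h)"
    and EE: "(\<lambda>h. E k h * E l h) \<in> O[F](\<lambda>h. p h * q h)" for k l
    by (auto intro: landau_o.big.mult)
  have "(\<lambda>h. 2 * (S 1 h * E 1 h) + E 1 h * E 1 h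
             - 4 * (S 2 h * E 0 h) - 4 * (S 0 h * E 2 h) - 4 * (E 2 h * E 0 h))
        \<in> O[F](\<lambda>h. p h * q h)"
    by (intro sum_in_bigo landau_o.big.cmult_in_iff[THEN iffD2] SE EE) simp_all
  also have "(\<lambda>h. 2 * (S 1 h * E 1 h) + E 1 h * E 1 h
             - 4 * (S 2 h * E 0 h) - 4 * (S 0 h * E 2 h) - 4 * (E 2 h * E 0 h))
      = (\<lambda>h. Delta n a (\<lambda>i. s h i + e h i) - Delta n a (s h))"
    by (simp add: Delta_eq_interp_coeff interp_coeff_add[OF inj] S_def E_def
        algebra_simps power2_eq_square)
  finally show ?thesis .
qed

section \<open>Step data\<close>

lemma Delta_step_pos:
  assumes n: "n \<ge> 3" and mono: "strict_mono_on {..n} a" and j: "j < n" and LR: "L \<noteq> R"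
  shows "Delta n a (\<lambda>i. if i \<le> j then L else R) > 0"
proof -
  have inj: "inj_on a {..n}"
    using mono by (rule strict_mono_on_imp_inj_on)
  define P where "P = interp_poly n a (\<lambda>i. if i \<le> j then L else R)"
  define Q where "Q = (pderiv ^^ (n - 2)) P"
  have deg: "degree P \<le> n" and val: "\<And>i. i \<le> n \<Longrightarrow> poly P (a i) = (if i \<le> j then L else R)"
    unfolding P_def using inj by (simp_all add: degree_interp_poly poly_interp_poly)
  have nz: "pderiv P \<noteq> 0"
  proof
    assume "pderiv P = 0"
    then obtain c where "P = [:c:]"
      by (metis pderiv_eq_0_iff degree_eq_zeroE)
    then show False
      using val[of j] val[of "Suc j"] j LR by simp
  qed
  \<comment> \<open>The data agree at both ends of every interval except the one from
    \<open>a j\<close> to \<open>a (Suc j)\<close>.\<close>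
  have "card ({..<n} - {j}) \<le> card {x. poly (pderiv P) x = 0}"
    using val by (intro card_le_card_pderiv_roots[OF mono _ _ nz]) auto
  then have roots: "n - 1 \<le> card {x. poly (pderiv P) x = 0}"
    using j by simp
  \<comment> \<open>The root count also bounds the degree from below, so \<open>P\<close> has degree
    exactly \<open>n\<close> and \<open>Q\<close> is a genuine quadratic.\<close>
  also have "\<dots> \<le> degree P - 1"
    using card_poly_roots_bound[OF nz] by (simp add: degree_pderiv)
  finally have "degree P = n"
    using deg n by simp
  then have degQ: "degree Q = 2"
    using n by (simp add: Q_def degree_higher_pderiv)
  \<comment> \<open>The count starts from \<open>pderiv P\<close> with its \<open>n - 1\<close>
    roots; each of the remaining \<open>n - 3\<close> derivatives costs at most one, leaving
    two.\<close>
  have "n - 2 = Suc (n - 3)"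
    using n by simp
  then have "Q = (pderiv ^^ (n - 3)) (pderiv P)"
    unfolding Q_def by (simp only: funpow_Suc_right o_apply)
  then have "n - 1 \<le> (n - 3) + card {x. poly Q x = 0}"
    using roots card_roots_le_card_higher_pderiv_roots[of "n - 3" "pderiv P"] degQ by fastforce
  then have "card {x. poly Q x = 0} \<ge> 2"
    using n by simp
  from discriminant_pos[OF degQ this] show ?thesis
    by (simp add: Delta_def Let_def Q_def P_def)
qed

text \<open>The step sits at the last index with value \<open>L\<close>. A node may coincide with
  \<open>z\<close> and then joins either side according to \<open>\<sigma> z\<close>; at most one
  node can do so, hence the pattern is still a single step.\<close>

lemma ex_step_index:
  fixes x :: "nat \<Rightarrow> real" and \<sigma> :: "real \<Rightarrow> real"
  assumes mono: "strict_mono_on {..n} x" and ends: "x 0 < z" "z < x n" and LR: "L \<noteq> R"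
    and left: "\<And>y. y < z \<Longrightarrow> \<sigma> y = L" and right: "\<And>y. z < y \<Longrightarrow> \<sigma> y = R"
    and z: "\<sigma> z \<in> {L, R}"
  shows "\<exists>j<n. \<forall>i\<le>n. \<sigma> (x i) = (if i \<le> j then L else R)"
proof -
  define J where "J = {i. i \<le> n \<and> \<sigma> (x i) = L}"
  have fin: "finite J" and "0 \<in> J"
    using left ends(1) by (auto simp: J_def)
  then have "Max J \<in> J"
    using Max_in[OF fin] by blast
  moreover have "n \<notin> J"
    using right[OF ends(2)] LR by (simp add: J_def)
  ultimately have "Max J < n"
    by (metis (mono_tags, lifting) J_def le_neq_implies_less mem_Collect_eq)
  have "\<sigma> (x i) = L" if "i \<le> Max J" for i
  proof (cases "i = Max J")
    case True
    then show ?thesis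
      using \<open>Max J \<in> J\<close> by (simp add: J_def)
  next
    case False
    have "\<sigma> (x (Max J)) = L"
      using \<open>Max J \<in> J\<close> by (simp add: J_def)
    then have "x (Max J) \<le> z"
      using right[of "x (Max J)"] LR by force
    moreover have "x i < x (Max J)"
      using False that \<open>Max J < n\<close> by (intro strict_mono_onD[OF mono]) auto
    ultimately show ?thesis
      using left by simp
  qed
  moreover have "\<sigma> (x i) = R" if "i \<le> n" "\<not> i \<le> Max J" for i
  proof -
    have "i \<notin> J"
      using that Max_ge[OF fin] by blast
    then show ?thesis
      using that left[of "x i"] right[of "x i"] z by (cases "x i" z rule: linorder_cases) (auto simp: J_def)
  qed
  ultimately show ?thesis
    using \<open>Max J < n\<close> by (intro exI[of _ "Max J"]) auto
qed

lemma tendsto_0_bigo: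
  fixes f g :: "'a \<Rightarrow> real"
  assumes "f \<in> O[F](g)" "(g \<longlongrightarrow> 0) F"
  shows "(f \<longlongrightarrow> 0) F"
proof -
  obtain c where "eventually (\<lambda>x. norm (f x) \<le> c * norm (g x)) F"
    using assms(1) by (elim landau_o.bigE)
  moreover have "((\<lambda>x. c * norm (g x)) \<longlongrightarrow> 0) F"
    using assms(2) by (intro tendsto_mult_right_zero tendsto_norm_zero)
  ultimately show ?thesis
    by (rule Lim_null_comparison)
qed

lemma bar_O_1I:
  assumes "c > 0" and "eventually (\<lambda>h. c \<le> \<bar>g h\<bar>) (at_right 0)"
    and "eventually (\<lambda>h. \<bar>g h\<bar> \<le> C) (at_right 0)"
  shows "bar_O_1 g"
proof -
  have "Limsup (at_right 0) (\<lambda>h. ereal \<bar>g h\<bar>) \<le> ereal C"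
    using assms(3) by (intro Limsup_bounded) simp
  moreover have "ereal c \<le> Liminf (at_right 0) (\<lambda>h. ereal \<bar>g h\<bar>)"
    using assms(2) by (intro Liminf_bounded) simp
  ultimately show ?thesis
    using assms(1) unfolding bar_O_1_def
    by (metis ereal_less(2) ereal_less_PInfty less_ereal.simps(4) order_le_less_trans order_less_le_trans)
qed

lemma bar_O_1_Delta_jump:
  fixes x :: "real \<Rightarrow> nat \<Rightarrow> real"
  assumes n: "n \<ge> 3" and a: "strict_mono_on {..n} a"
    and x: "\<And>h. h > 0 \<Longrightarrow> strict_mono_on {..n} (x h)"
    and lim: "\<And>i. ((\<lambda>h. x h i) \<longlongrightarrow> z) (at_right 0)"
    and ends: "eventually (\<lambda>h. x h 0 < z \<and> z < x h n) (at_right 0)"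
    and jump: "jump_discontinuity f z"
  shows "bar_O_1 (\<lambda>h. Delta n a (\<lambda>i. f (x h i)))"
proof -
  have inj: "inj_on a {..n}"
    using a by (rule strict_mono_on_imp_inj_on)
  obtain L R where L: "(f \<longlongrightarrow> L) (at_left z)" and R: "(f \<longlongrightarrow> R) (at_right z)"
    and LR: "L \<noteq> R" "f z \<in> {L, R}"
    using jump by (auto simp: jump_discontinuity_def)
  \<comment> \<open>Each side of \<open>f\<close> is replaced by its one-sided limit and the value
    at \<open>z\<close> is kept. Thus \<open>f - \<sigma>\<close> tends to 0 along
    \<open>nhds z\<close>, which covers a node lying on \<open>z\<close> itself.\<close>
  define \<sigma> where "\<sigma> y = (if y < z then L else if z < y then R else f z)" for y
  define s where "s h i = \<sigma> (x h i)" for h i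
  define e where "e h i = f (x h i) - \<sigma> (x h i)" for h i
  have se: "s h i + e h i = f (x h i)" for h i
    by (simp add: s_def e_def)
  \<comment> \<open>No rate of convergence is known at a jump, so the total error itself serves as
    the comparison function.\<close>
  define q where "q h = (\<Sum>i\<le>n. \<bar>e h i\<bar>)" for h

  have "((\<lambda>y. f y - \<sigma> y) \<longlongrightarrow> 0) (at_left z)"
    by (rule Lim_transform_eventually[OF LIM_zero[OF L]]) (simp add: eventually_at_filter \<sigma>_def)
  moreover have "((\<lambda>y. f y - \<sigma> y) \<longlongrightarrow> 0) (at_right z)"
    by (rule Lim_transform_eventually[OF LIM_zero[OF R]]) (simp add: eventually_at_filter \<sigma>_def)
  ultimately have "((\<lambda>y. f y - \<sigma> y) \<longlongrightarrow> 0) (at z)"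
    by (rule filterlim_split_at)
  then have "((\<lambda>y. f y - \<sigma> y) \<longlongrightarrow> 0) (nhds z)"
    by (simp add: tendsto_nhds_iff \<sigma>_def)
  then have e: "((\<lambda>h. e h i) \<longlongrightarrow> 0) (at_right 0)" for i
    unfolding e_def using lim by (rule filterlim_compose)
  then have "(q \<longlongrightarrow> (\<Sum>i\<le>n. \<bar>0\<bar>)) (at_right 0)"
    unfolding q_def by (intro tendsto_intros)
  then have q: "(q \<longlongrightarrow> 0) (at_right 0)"
    by simp

  have "(\<lambda>h. Delta n a (\<lambda>i. s h i + e h i) - Delta n a (s h)) \<in> O[at_right 0](\<lambda>h. 1 * q h)"
  proof (rule Delta_perturb_bigo[OF inj])
    show "(\<lambda>h. interp_coeff n a k (s h)) \<in> O[at_right 0](\<lambda>h. 1)" for k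
    proof -
      have "\<bar>\<sigma> y\<bar> \<le> \<bar>L\<bar> + \<bar>R\<bar>" for y
        using LR(2) by (auto simp: \<sigma>_def)
      then show ?thesis
        by (intro interp_coeff_bigo[OF inj] bigoI[where c = "\<bar>L\<bar> + \<bar>R\<bar>"]) (simp add: s_def)
    qed
    show "(\<lambda>h. e h i) \<in> O[at_right 0](q)" if "i \<le> n" for i
    proof (rule bigoI[where c = 1], rule always_eventually, rule allI)
      fix h
      have "\<bar>e h i\<bar> \<le> q h"
        unfolding q_def using that by (intro member_le_sum) auto
      then show "norm (e h i) \<le> 1 * norm (q h)"
        by simp
    qed
    show "q \<in> O[at_right 0](\<lambda>h. 1)"
      using q by (intro bigoI_tendsto[where c = 0]) simp_all
  qed
  then have diff: "((\<lambda>h. Delta n a (\<lambda>i. f (x h i)) - Delta n a (s h)) \<longlongrightarrow> 0) (at_right 0)"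
    by (intro tendsto_0_bigo[OF _ q]) (simp only: mult_1 se)

  \<comment> \<open>The step index may change with \<open>h\<close> forever, so
    \<open>Delta n a (s h)\<close> need not converge; it does stay in this finite set of positive
    numbers.\<close>
  define V where "V = (\<lambda>j. Delta n a (\<lambda>i. if i \<le> j then L else R)) ` {..<n}"
  have V: "finite V" "V \<noteq> {}"
    using n by (auto simp: V_def lessThan_empty_iff)
  have pos: "Min V > 0"
    using V Delta_step_pos[OF n a _ LR(1)] by (auto simp: V_def)
  have "eventually (\<lambda>h. Delta n a (s h) \<in> V) (at_right 0)"
    using ends eventually_at_right_less[of 0]
  proof eventually_elim
    case (elim h)
    have "\<exists>j<n. \<forall>i\<le>n. \<sigma> (x h i) = (if i \<le> j then L else R)"
      using elim LR x by (intro ex_step_index) (auto simp: \<sigma>_def)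
    then obtain j where "j < n" "\<And>i. i \<le> n \<Longrightarrow> s h i = (if i \<le> j then L else R)"
      by (auto simp: s_def)
    then show ?case
      using Delta_cong[of n "s h"] by (auto simp: V_def)
  qed
  \<comment> \<open>The tolerance \<open>Min V / 2\<close> leaves a lower bound of
    \<open>Min V / 2\<close>.\<close>
  moreover have "eventually (\<lambda>h. \<bar>Delta n a (\<lambda>i. f (x h i)) - Delta n a (s h)\<bar> < Min V / 2) (at_right 0)"
    using tendstoD[OF diff, of "Min V / 2"] pos by (simp add: dist_real_def)
  ultimately have "eventually (\<lambda>h. Min V / 2 \<le> \<bar>Delta n a (\<lambda>i. f (x h i))\<bar> \<and>
      \<bar>Delta n a (\<lambda>i. f (x h i))\<bar> \<le> Max V + Min V / 2) (at_right 0)"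
  proof eventually_elim
    case (elim h)
    have "Min V \<le> Delta n a (s h)" "Delta n a (s h) \<le> Max V"
      using V elim(1) by auto
    then show ?case
      using elim(2) pos by linarith
  qed
  then show ?thesis
    using pos by (intro bar_O_1I[of "Min V / 2" _ "Max V + Min V / 2"])
      (simp_all add: eventually_conj_iff)
qed

section \<open>Smooth data\<close>

text \<open>Each derivative brings down the exponent and one factor \<open>h\<close> by the chain
  rule. Writing the exponent as \<open>m + r\<close> avoids truncated subtraction.\<close>

lemma higher_pderiv_linear_power:
  fixes s h :: real
  shows "(pderiv ^^ m) ([:s, h:] ^ (m + r)) = smult (h ^ m * fact (m + r) / fact r) ([:s, h:] ^ r)"
proof (induction m)
  case (Suc m)
  have "pderiv ([:s, h:] ^ (Suc m + r)) = smult (h * real (Suc (m + r))) ([:s, h:] ^ (m + r))"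
    by (simp add: pderiv_power_Suc pderiv_pCons mult.commute del: power_Suc of_nat_Suc)
  then show ?case
    using Suc by (simp add: funpow_Suc_right higher_pderiv_smult algebra_simps del: funpow.simps power_Suc)
      (simp add: algebra_simps)
qed simp

text \<open>The data are values of a polynomial of degree at most \<open>n\<close>, which is
  therefore its own interpolant; \<open>n - 2\<close> derivatives reduce its power to a
  square.\<close>

lemma interp_coeff_linear_power:
  assumes inj: "inj_on a {..n}" and n: "n \<ge> 3"
  shows "interp_coeff n a k (\<lambda>i. b + c * (s + a i * h) ^ n)
    = c * (h ^ (n - 2) * fact n / 2) * poly.coeff ([:s, h:]\<^sup>2) k"
proof -
  define P where "P = [:b:] + smult c ([:s, h:] ^ n)"
  have "interp_poly n a (\<lambda>i. b + c * (s + a i * h) ^ n) = P"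
  proof (rule interp_poly_eqI[OF inj])
    have "degree ([:s, h:] ^ n) \<le> n"
      using degree_power_le[of "[:s, h:]" n] by (rule order_trans) simp
    then show "degree P \<le> n"
      unfolding P_def by (intro degree_add_le) (auto intro: order_trans[OF degree_smult_le])
  qed (simp add: P_def poly_power mult.commute)
  \<comment> \<open>By \<open>n \<ge> 3\<close> at least one derivative is taken, which removes the
    constant.\<close>
  moreover have "(pderiv ^^ (n - 2)) [:b:] = 0"
  proof -
    obtain m where "n - 2 = Suc m"
      using n by (metis Suc_diff_Suc Suc_le_lessD eval_nat_numeral(3))
    then show ?thesis
      by (simp add: funpow_Suc_right pderiv_pCons del: funpow.simps)
  qed
  moreover have "(pderiv ^^ (n - 2)) ([:s, h:] ^ n) = smult (h ^ (n - 2) * fact n / 2) ([:s, h:]\<^sup>2)"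
    using higher_pderiv_linear_power[of "n - 2" s h 2] n by (simp only: le_add_diff_inverse2) simp
  ultimately show ?thesis
    by (simp add: interp_coeff_def P_def higher_pderiv_add higher_pderiv_smult)
qed

lemma Delta_linear_power:
  assumes "inj_on a {..n}" and "n \<ge> 3"
  shows "Delta n a (\<lambda>i. b + c * (s + a i * h) ^ n) = 0"
proof -
  have "poly.coeff ([:s, h:]\<^sup>2) 0 = s\<^sup>2" "poly.coeff ([:s, h:]\<^sup>2) 1 = 2 * s * h"
    "poly.coeff ([:s, h:]\<^sup>2) 2 = h\<^sup>2"
    by (simp_all add: power2_eq_square numeral_2_eq_2)
  then show ?thesis
    unfolding Delta_eq_interp_coeff interp_coeff_linear_power[OF assms]
    by (simp add: power_mult_distrib power2_eq_square)
qed

text \<open>Lagrange's form of the remainder, with the derivative of order \<open>n + 1\<close>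
  bounded on a compact ball by continuity.\<close>

lemma Taylor_remainder_bigo:
  fixes f :: "real \<Rightarrow> real"
  assumes "open U" "z \<in> U" and C: "C_class_on (n + 1) f U"
    and zero: "\<And>l. 1 \<le> l \<Longrightarrow> l < n \<Longrightarrow> (deriv ^^ l) f z = 0" and n: "n \<ge> 1"
  shows "(\<lambda>x. f x - (f z + (deriv ^^ n) f z / fact n * (x - z) ^ n))
    \<in> O[nhds z](\<lambda>x. (x - z) ^ (n + 1))"
proof -
  obtain d where d: "d > 0" "cball z d \<subseteq> U"
    using assms(1,2) open_contains_cball by blast
  have "continuous_on (cball z d) ((deriv ^^ (n + 1)) f)"
    using C d(2) by (auto simp: C_class_on_def intro: continuous_on_subset)
  then have "bounded ((deriv ^^ (n + 1)) f ` cball z d)"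
    by (intro compact_imp_bounded compact_continuous_image) auto
  then obtain B where B: "\<And>x. x \<in> cball z d \<Longrightarrow> \<bar>(deriv ^^ (n + 1)) f x\<bar> \<le> B"
    unfolding bounded_iff real_norm_def by blast
  have deriv: "DERIV ((deriv ^^ m) f) t :> (deriv ^^ (Suc m)) f t"
    if "m < n + 1" "z - d \<le> t" "t \<le> z + d" for m t
  proof -
    have "t \<in> U"
      using d(2) that by (intro subsetD[OF d(2)]) (auto simp: dist_real_def)
    then show ?thesis
      using C that(1) by (auto simp: C_class_on_def DERIV_deriv_iff_field_differentiable)
  qed
  have bound: "\<bar>f x - (f z + (deriv ^^ n) f z / fact n * (x - z) ^ n)\<bar> \<le> B / fact (n + 1) * \<bar>(x - z) ^ (n + 1)\<bar>"
    if "x \<in> cball z d" for x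
  \<comment> \<open>Taylor's theorem needs a point different from the centre. At the centre both
    sides vanish, since \<open>0 ^ n = 0\<close> for \<open>n \<ge> 1\<close>.\<close>
  proof (cases "x = z")
    case True
    then show ?thesis
      using n by (simp add: power_0_left)
  next
    case False
    have "\<exists>t. (if x < z then x < t \<and> t < z else z < t \<and> t < x) \<and>
        f x = (\<Sum>m<n + 1. (deriv ^^ m) f z / fact m * (x - z) ^ m)
          + (deriv ^^ (n + 1)) f t / fact (n + 1) * (x - z) ^ (n + 1)"
      using that False d(1) deriv
      by (intro Taylor[where a = "z - d" and b = "z + d"]) (auto simp: dist_real_def)
    then obtain t where t: "if x < z then x < t \<and> t < z else z < t \<and> t < x"
      and fx: "f x = (\<Sum>m<n + 1. (deriv ^^ m) f z / fact m * (x - z) ^ m)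
          + (deriv ^^ (n + 1)) f t / fact (n + 1) * (x - z) ^ (n + 1)"
      by blast
    \<comment> \<open>Only the orders 0 and \<open>n\<close> survive; they are distinct because
      \<open>n \<ge> 1\<close>.\<close>
    have "(\<Sum>m<n + 1. (deriv ^^ m) f z / fact m * (x - z) ^ m)
        = (\<Sum>m\<in>{0, n}. (deriv ^^ m) f z / fact m * (x - z) ^ m)"
      using zero by (intro sum.mono_neutral_right) (auto simp: Suc_le_eq)
    also have "\<dots> = f z + (deriv ^^ n) f z / fact n * (x - z) ^ n"
      using n by simp
    finally have "f x - (f z + (deriv ^^ n) f z / fact n * (x - z) ^ n)
        = (deriv ^^ (n + 1)) f t / fact (n + 1) * (x - z) ^ (n + 1)"
      by (simp only: fx add_diff_cancel_left')
    moreover have "\<bar>(deriv ^^ (n + 1)) f t\<bar> \<le> B"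
      using t that by (intro B) (auto simp: dist_real_def split: if_splits)
    ultimately show ?thesis
      by (simp only: abs_mult abs_divide abs_of_pos fact_gt_zero) (intro mult_right_mono divide_right_mono abs_ge_zero fact_ge_zero)
  qed
  have "eventually (\<lambda>x. x \<in> ball z d) (nhds z)"
    using d(1) by (intro eventually_nhds_in_open) auto
  then show ?thesis
  proof (intro bigoI[where c = "B / fact (n + 1)"], elim eventually_mono)
    fix x
    assume "x \<in> ball z d"
    then show "norm (f x - (f z + (deriv ^^ n) f z / fact n * (x - z) ^ n))
        \<le> B / fact (n + 1) * norm ((x - z) ^ (n + 1))"
      unfolding real_norm_def by (intro bound) simp
  qed
qed

text \<open>The perturbation lemma with \<open>p = h^n\<close> and \<open>q = h^(n+1)\<close>,
  around leading data on which \<open>Delta\<close> vanishes.\<close>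

lemma Delta_smooth_bigo:
  assumes n: "n \<ge> 3" and inj: "inj_on a {..n}"
    and zh: "(\<lambda>h. zh h - z) \<in> O[at_right 0](\<lambda>h. h)"
    and lim: "\<And>i. ((\<lambda>h. zh h + a i * h) \<longlongrightarrow> z) (at_right 0)"
    and f: "(\<lambda>x. f x - (f z + c * (x - z) ^ n)) \<in> O[nhds z](\<lambda>x. (x - z) ^ (n + 1))"
  shows "(\<lambda>h. Delta n a (\<lambda>i. f (zh h + a i * h))) \<in> O[at_right 0](\<lambda>h. h ^ (2 * n + 1))"
proof -
  define s where "s h i = f z + c * ((zh h - z) + a i * h) ^ n" for h i
  define e where "e h i = f (zh h + a i * h) - s h i" for h i
  have node: "(\<lambda>h. zh h + a i * h - z) \<in> O[at_right 0](\<lambda>h. h)" for i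
  proof -
    have "(\<lambda>h. (zh h - z) + a i * h) \<in> O[at_right 0](\<lambda>h. h)"
      using zh by (intro sum_in_bigo(1)) auto
    then show ?thesis
      by (simp add: algebra_simps)
  qed
  have s: "(\<lambda>h. interp_coeff n a k (s h)) \<in> O[at_right 0](\<lambda>h. h ^ n)" for k
  proof -
    \<comment> \<open>The coefficients are \<open>(zh h - z)\<^sup>2\<close>,
      \<open>2 * h * (zh h - z)\<close>, \<open>h\<^sup>2\<close> and then 0. The factor
      \<open>h ^ (n - 2)\<close> from differentiation completes the order \<open>n\<close>.\<close>
    have "(\<lambda>h. poly.coeff ([:zh h - z, h:]\<^sup>2) k) \<in> O[at_right 0](\<lambda>h. h * h)"
    proof -
      have sq: "(\<lambda>h. (zh h - z) * (zh h - z)) \<in> O[at_right 0](\<lambda>h. h * h)"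
        and mixed: "(\<lambda>h. h * (zh h - z)) \<in> O[at_right 0](\<lambda>h. h * h)"
        by (rule landau_o.big.mult[OF zh zh], rule landau_o.big.mult[OF landau_o.big_refl zh])
      consider "k = 0" | "k = 1" | "k = 2" | m where "k = Suc (Suc (Suc m))"
        by (metis One_nat_def numeral_2_eq_2 not0_implies_Suc)
      then show ?thesis
        by cases (use sq mixed in \<open>simp_all add: power2_eq_square numeral_2_eq_2\<close>)
    qed
    then have "(\<lambda>h. h ^ (n - 2) * poly.coeff ([:zh h - z, h:]\<^sup>2) k)
        \<in> O[at_right 0](\<lambda>h. h ^ (n - 2) * (h * h))"
      by (intro landau_o.big.mult) auto
    also have "(\<lambda>h::real. h ^ (n - 2) * (h * h)) = (\<lambda>h. h ^ n)"
    proof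
      fix h :: real
      have "h ^ n = h ^ (n - 2 + 2)"
        using n by (simp only: le_add_diff_inverse2)
      then show "h ^ (n - 2) * (h * h) = h ^ n"
        by (simp only: power_add power2_eq_square)
    qed
    finally have "(\<lambda>h. (c * fact n / 2) * (h ^ (n - 2) * poly.coeff ([:zh h - z, h:]\<^sup>2) k))
        \<in> O[at_right 0](\<lambda>h. h ^ n)"
      \<comment> \<open>Cancelling a constant factor inside a Landau class requires it to be
        nonzero.\<close>
      by (cases "c = 0") simp_all
    moreover have "interp_coeff n a k (s h)
        = (c * fact n / 2) * (h ^ (n - 2) * poly.coeff ([:zh h - z, h:]\<^sup>2) k)" for h
      unfolding s_def [abs_def] interp_coeff_linear_power[OF inj n] by simp
    ultimately show ?thesis
      by (simp only:)
  qed
  have "(\<lambda>h. Delta n a (\<lambda>i. s h i + e h i) - Delta n a (s h))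
      \<in> O[at_right 0](\<lambda>h. h ^ n * h ^ (n + 1))"
    (is "_ \<in> O[_](?g)")
  proof (rule Delta_perturb_bigo[OF inj s])
    show "(\<lambda>h. e h i) \<in> O[at_right 0](\<lambda>h. h ^ (n + 1))" for i
    proof -
      \<comment> \<open>The Taylor estimate is pulled back along the \<open>i\<close>-th node, which
        tends to \<open>z\<close>.\<close>
      have "(\<lambda>h. e h i) \<in> O[at_right 0](\<lambda>h. (zh h + a i * h - z) ^ (n + 1))"
        using landau_o.big.compose[OF f lim[of i]] unfolding e_def s_def diff_add_eq .
      also have "(\<lambda>h. (zh h + a i * h - z) ^ (n + 1)) \<in> O[at_right 0](\<lambda>h. h ^ (n + 1))"
        using node by (rule landau_o.big_power)
      finally show ?thesis .
    qed
    have "eventually (\<lambda>h::real. h < 1) (at_right 0)"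
      using eventually_at_right_real[of 0 "1::real"] by (rule eventually_mono) simp_all
    then show "(\<lambda>h::real. h ^ (n + 1)) \<in> O[at_right 0](\<lambda>h. h ^ n)"
      using eventually_at_right_less[of "0::real"]
    proof (intro bigoI[where c = 1], eventually_elim)
      case (elim h)
      then have "h ^ (n + 1) \<le> h ^ n"
        by (intro power_decreasing) auto
      with elim show ?case
        by simp
    qed
  qed
  moreover have "?g = (\<lambda>h. h ^ (2 * n + 1))"
    by (simp only: mult_2 add.assoc power_add)
  moreover have "Delta n a (s h) = 0" for h
    unfolding s_def [abs_def] using inj n by (rule Delta_linear_power)
  ultimately show ?thesis
    by (simp only: e_def add_diff_cancel_left' diff_zero add_diff_eq)
qed

theorem theorem3p3:
  fixes n :: nat and z :: real and zh :: "real \<Rightarrow> real" and a :: "nat \<Rightarrow> real"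
    and f :: "real \<Rightarrow> real"
  assumes "n \<ge> 3"
    and "(\<lambda>h. zh h - z) \<in> O[at_right 0](\<lambda>h. h)"
    and "strict_mono_on {..n} a"
  shows "((\<exists>h0>0. \<forall>h. 0 < h \<and> h < h0 \<longrightarrow> zh h + a 0 * h < z \<and> z < zh h + a n * h) \<and>
          jump_discontinuity f z
          \<longrightarrow> bar_O_1 (\<lambda>h. Delta n a (\<lambda>i. f (zh h + a i * h))))
       \<and> ((\<exists>U. open U \<and> z \<in> U \<and> C_class_on (n + 1) f U) \<and>
          (\<forall>l. 1 \<le> l \<and> l \<le> n - 1 \<longrightarrow> (deriv ^^ l) f z = 0) \<and>
          (deriv ^^ n) f z \<noteq> 0
          \<longrightarrow> (\<lambda>h. Delta n a (\<lambda>i. f (zh h + a i * h))) \<in> O[at_right 0](\<lambda>h. h ^ (2 * n + 1)))"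
proof -
  have inj: "inj_on a {..n}"
    using assms(3) by (rule strict_mono_on_imp_inj_on)
  \<comment> \<open>Both claims need every node to converge to \<open>z\<close>; this follows from
    \<open>zh h - z\<close> being \<open>O(h)\<close>.\<close>
  have "((\<lambda>h. zh h - z) \<longlongrightarrow> 0) (at_right 0)"
    using assms(2) by (rule tendsto_0_bigo) (rule tendsto_ident_at)
  then have "((\<lambda>h. z + (zh h - z) + a i * h) \<longlongrightarrow> z + 0 + a i * 0) (at_right 0)" for i
    by (intro tendsto_add tendsto_mult tendsto_const tendsto_ident_at)
  then have lim: "((\<lambda>h. zh h + a i * h) \<longlongrightarrow> z) (at_right 0)" for i
    by simp
  show ?thesis
  proof (intro conjI impI; elim conjE exE)
    fix h0
    assume h0: "h0 > 0" "\<forall>h. 0 < h \<and> h < h0 \<longrightarrow> zh h + a 0 * h < z \<and> z < zh h + a n * h"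
      and jump: "jump_discontinuity f z"
    have "eventually (\<lambda>h. zh h + a 0 * h < z \<and> z < zh h + a n * h) (at_right 0)"
      using eventually_at_right_real[OF h0(1)] by (rule eventually_mono) (use h0(2) in auto)
    moreover have "strict_mono_on {..n} (\<lambda>i. zh h + a i * h)" if "h > 0" for h
      using assms(3) that by (auto simp: strict_mono_on_def)
    ultimately show "bar_O_1 (\<lambda>h. Delta n a (\<lambda>i. f (zh h + a i * h)))"
      by (intro bar_O_1_Delta_jump[where x = "\<lambda>h i. zh h + a i * h" and z = z] assms(1,3) lim jump)
  next
    fix U
    assume U: "open U" "z \<in> U" "C_class_on (n + 1) f U"
      and zero: "\<forall>l. 1 \<le> l \<and> l \<le> n - 1 \<longrightarrow> (deriv ^^ l) f z = 0"
    have "(\<lambda>x. f x - (f z + (deriv ^^ n) f z / fact n * (x - z) ^ n))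
        \<in> O[nhds z](\<lambda>x. (x - z) ^ (n + 1))"
      using zero assms(1) by (intro Taylor_remainder_bigo[OF U]) auto
    then show "(\<lambda>h. Delta n a (\<lambda>i. f (zh h + a i * h))) \<in> O[at_right 0](\<lambda>h. h ^ (2 * n + 1))"
      by (rule Delta_smooth_bigo[OF assms(1) inj assms(2) lim])
  qed
qed

end
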